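(* Let $G$ be a topological semigroup with identity acting continuously on a compact Hausdorff space $X$ by surjective continuous maps. Let $k\ge2$ and $(x_1,\dots,x_k)\in X^k\setminus\Delta_k(X)$. Then $(x_1,\dots,x_k)$ is a sequence entropy tuple if and only if it is an IN-tuple.
   Context: $\Delta_k(X)=\{(x,\dots,x)\}$. For $s\in G$ and $A\subseteq X$, $s^{-1}A=\{x\in X: sx\in A\}$. For a sequence $\mathfrak s=\{s_n\}_{n\in{\mathbb N}}$ in $G$ and a finite open cover ${\mathcal U}$ of $X$, ${\rm h}_{\rm top}(X,{\mathcal U};\mathfrak s)=\limsup_{n\to\infty}\frac1n\log N(\bigvee_{i=1}^n s_i^{-1}{\mathcal U})$, where $N(\cdot)$ is the minimal cardinality of a subcover. A tuple $(x_1,\dots,x_k)\in X^k\setminus\Delta_k(X)$ is a sequence entropy tuple if whenever $U_1,\dots,U_l$ are closed pairwise disjoint neighbourhoods of the distinct points in the list $x_1,\dots,x_k$, there is a sequence $\mathfrak s$ in $G$ with ${\rm h}_{\rm top}(X,\{U_1^{\rm c},\dots,U_l^{\rm c}\};\mathfrak s)>0$. For a tuple $(A_1,\dots,A_k)$ of subsets of $X$, $J\subseteq G$ is an independence set if for every nonempty finite $I\subseteq J$ and $\sigma:I\to\{1,\dots,k\}$, $\bigcap_{s\in I}s^{-1}A_{\sigma(s)}\neq\emptyset$. A tuple $(x_1,\dots,x_k)\in X^k$ is an IN-tuple if for every product neighbourhood $U_1\times\cdots\times U_k$ of it, $(U_1,\dots,U_k)$ has arbitrarily large finite independence sets. *)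

theory Defs
  imports "HOL-Analysis.Analysis" "HOL-Library.Extended_Real"
begin

definition top_monoid_action :: "('g::{topological_space,monoid_mult} \<Rightarrow> 'x::t2_space \<Rightarrow> 'x) \<Rightarrow> bool" where
  "top_monoid_action act \<longleftrightarrow>
     continuous_on UNIV (\<lambda>p::'g \<times> 'g. fst p * snd p) \<and>
     compact (UNIV :: 'x set) \<and>
     continuous_on UNIV (\<lambda>p::'g \<times> 'x. act (fst p) (snd p)) \<and>
     (\<forall>x. act 1 x = x) \<and>
     (\<forall>s t x. act (s * t) x = act s (act t x)) \<and>
     (\<forall>s. surj (act s))"

definition N_cover :: "'x set set \<Rightarrow> nat" where
  "N_cover C = (LEAST n. \<exists>F. F \<subseteq> C \<and> finite F \<and> card F = n \<and> \<Union>F = UNIV)"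

definition join_seq :: "('g \<Rightarrow> 'x \<Rightarrow> 'x) \<Rightarrow> (nat \<Rightarrow> 'g) \<Rightarrow> 'x set set \<Rightarrow> nat \<Rightarrow> 'x set set" where
  "join_seq act s U n =
     {(\<Inter>i\<in>{1..n}. act (s i) -` V i) | V. \<forall>i\<in>{1..n}. V i \<in> U}"

definition htop_seq :: "('g \<Rightarrow> 'x \<Rightarrow> 'x) \<Rightarrow> 'x set set \<Rightarrow> (nat \<Rightarrow> 'g) \<Rightarrow> ereal" where
  "htop_seq act U s =
     limsup (\<lambda>n. ereal (ln (real (N_cover (join_seq act s U n))) / real n))"

text \<open>Tuples are x 0, ..., x (k-1).\<close>
definition in_diagonal :: "nat \<Rightarrow> (nat \<Rightarrow> 'x) \<Rightarrow> bool" where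
  "in_diagonal k x \<longleftrightarrow> (\<forall>i<k. \<forall>j<k. x i = x j)"

definition seq_entropy_tuple :: "('g \<Rightarrow> 'x::topological_space \<Rightarrow> 'x) \<Rightarrow> nat \<Rightarrow> (nat \<Rightarrow> 'x) \<Rightarrow> bool" where
  "seq_entropy_tuple act k x \<longleftrightarrow>
     \<not> in_diagonal k x \<and>
     (\<forall>U :: 'x \<Rightarrow> 'x set.
        (\<forall>p\<in>x ` {..<k}. closed (U p) \<and> p \<in> interior (U p)) \<and>
        (\<forall>p\<in>x ` {..<k}. \<forall>q\<in>x ` {..<k}. p \<noteq> q \<longrightarrow> U p \<inter> U q = {})
        \<longrightarrow> (\<exists>s :: nat \<Rightarrow> 'g. htop_seq act ((\<lambda>p. - U p) ` (x ` {..<k})) s > 0))"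

definition independence_set :: "('g \<Rightarrow> 'x \<Rightarrow> 'x) \<Rightarrow> nat \<Rightarrow> (nat \<Rightarrow> 'x set) \<Rightarrow> 'g set \<Rightarrow> bool" where
  "independence_set act k A J \<longleftrightarrow>
     (\<forall>I. I \<subseteq> J \<and> finite I \<and> I \<noteq> {} \<longrightarrow>
        (\<forall>\<sigma>. (\<forall>s\<in>I. \<sigma> s < k) \<longrightarrow> (\<Inter>s\<in>I. act s -` A (\<sigma> s)) \<noteq> {}))"

definition IN_tuple :: "('g \<Rightarrow> 'x::topological_space \<Rightarrow> 'x) \<Rightarrow> nat \<Rightarrow> (nat \<Rightarrow> 'x) \<Rightarrow> bool" where
  "IN_tuple act k x \<longleftrightarrow>
     (\<forall>U :: nat \<Rightarrow> 'x set. (\<forall>i<k. x i \<in> interior (U i)) \<longrightarrow>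
        (\<forall>n. \<exists>J. finite J \<and> card J \<ge> n \<and> independence_set act k U J))"

end

theory Submission
  imports Defs "HOL-Real_Asymp.Real_Asymp"
begin

text \<open>
  For a finite disjoint family of l labelled sets, a cover of X by members of the n-th join of the
  complements amounts to a family of words of length n such that the itinerary of every point
  disagrees at all times with some word of the family. A word disagrees everywhere with at most
  (l - 1)^r of the l^r labellings of an independence set of size r, so large independence sets
  force large covers. Conversely, if independence sets have size at most M, then the number of
  independent subsets of the first n times is polynomial in n; one of the l labels at a given time
  cuts this number by the factor 1 - 1/l, so avoiding these labels one time after the other goes
  wrong only O(ln n) times, and exp (O((ln n)^2)) words suffice.
\<close>

section \<open>Shattering by labelled families\<close>

definition shatters :: "('i \<Rightarrow> 'p \<Rightarrow> 'a set) \<Rightarrow> 'p set \<Rightarrow> 'a set \<Rightarrow> 'i set \<Rightarrow> bool" where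
  "shatters A P S W \<longleftrightarrow> (\<forall>\<sigma>\<in>W \<rightarrow> P. \<exists>y\<in>S. \<forall>z\<in>W. y \<in> A z (\<sigma> z))"

lemma shattersE:
  assumes "shatters A P S W" "\<And>z. z \<in> W \<Longrightarrow> \<sigma> z \<in> P"
  obtains y where "y \<in> S" "\<And>z. z \<in> W \<Longrightarrow> y \<in> A z (\<sigma> z)"
  using assms unfolding shatters_def Pi_iff by blast

lemma shatters_empty [simp]: "shatters A P S {} \<longleftrightarrow> S \<noteq> {}"
  by (auto simp: shatters_def)

lemma shatters_mono:
  assumes "shatters A P S W" "S \<subseteq> T" "\<And>z p. z \<in> W \<Longrightarrow> p \<in> P \<Longrightarrow> A z p \<subseteq> B z p"
  shows "shatters B P T W"
  unfolding shatters_def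
proof
  fix \<sigma> assume \<sigma>: "\<sigma> \<in> W \<rightarrow> P"
  then obtain y where "y \<in> S" "\<And>z. z \<in> W \<Longrightarrow> y \<in> A z (\<sigma> z)"
    using shattersE[OF assms(1), of \<sigma>] by blast
  then show "\<exists>y\<in>T. \<forall>z\<in>W. y \<in> B z (\<sigma> z)"
    using assms(2,3) \<sigma> by blast
qed

lemma shatters_subset:
  assumes "shatters A P S W" "V \<subseteq> W" "P \<noteq> {}"
  shows "shatters A P S V"
  unfolding shatters_def
proof
  fix \<sigma> assume \<sigma>: "\<sigma> \<in> V \<rightarrow> P"
  obtain p where "p \<in> P" using assms(3) by blast
  then have "(if z \<in> V then \<sigma> z else p) \<in> P" for z
    using \<sigma> by auto
  then obtain y where y: "y \<in> S" "\<And>z. z \<in> W \<Longrightarrow> y \<in> A z (if z \<in> V then \<sigma> z else p)"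
    using shattersE[OF assms(1), of "\<lambda>z. if z \<in> V then \<sigma> z else p"] by blast
  have "y \<in> A z (\<sigma> z)" if "z \<in> V" for z
    using y(2)[of z] that assms(2) by auto
  then show "\<exists>y\<in>S. \<forall>z\<in>V. y \<in> A z (\<sigma> z)"
    using y(1) by blast
qed

lemma shatters_insert:
  assumes "\<And>p. p \<in> P \<Longrightarrow> shatters A P (S \<inter> A z p) W"
  shows "shatters A P S (insert z W)"
  unfolding shatters_def
proof
  fix \<sigma> assume \<sigma>: "\<sigma> \<in> insert z W \<rightarrow> P"
  then obtain y where "y \<in> S \<inter> A z (\<sigma> z)" "\<And>w. w \<in> W \<Longrightarrow> y \<in> A w (\<sigma> w)"
    using shattersE[OF assms, of "\<sigma> z" \<sigma>] by blast
  then show "\<exists>y\<in>S. \<forall>w\<in>insert z W. y \<in> A w (\<sigma> w)"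
    by blast
qed

lemma shatters_image_labels:
  "shatters A (f ` K) S W \<longleftrightarrow> shatters (\<lambda>z j. A z (f j)) K S W"
proof
  assume shatters: "shatters A (f ` K) S W"
  show "shatters (\<lambda>z j. A z (f j)) K S W"
    unfolding shatters_def
  proof
    fix \<rho> assume \<rho>: "\<rho> \<in> W \<rightarrow> K"
    obtain y where "y \<in> S" "\<And>z. z \<in> W \<Longrightarrow> y \<in> A z (f (\<rho> z))"
      using shattersE[OF shatters, of "\<lambda>z. f (\<rho> z)"] \<rho> by blast
    then show "\<exists>y\<in>S. \<forall>z\<in>W. y \<in> A z (f (\<rho> z))"
      by blast
  qed
next
  assume shatters: "shatters (\<lambda>z j. A z (f j)) K S W"
  show "shatters A (f ` K) S W"
    unfolding shatters_def
  proof
    fix \<sigma> assume "\<sigma> \<in> W \<rightarrow> f ` K"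
    then obtain \<rho> where \<rho>: "\<And>z. z \<in> W \<Longrightarrow> \<rho> z \<in> K \<and> \<sigma> z = f (\<rho> z)"
      unfolding Pi_iff image_iff by metis
    obtain y where "y \<in> S" "\<And>z. z \<in> W \<Longrightarrow> y \<in> A z (f (\<rho> z))"
      using shattersE[OF shatters, of \<rho>] \<rho> by blast
    then show "\<exists>y\<in>S. \<forall>z\<in>W. y \<in> A z (\<sigma> z)"
      using \<rho> by auto
  qed
qed

lemma shatters_image_if_comp:
  assumes "shatters (A \<circ> s) P S W"
  shows "shatters A P S (s ` W)"
  unfolding shatters_def
proof
  fix \<sigma> assume "\<sigma> \<in> s ` W \<rightarrow> P"
  then have "(\<sigma> \<circ> s) i \<in> P" if "i \<in> W" for i
    using that by auto
  then obtain y where "y \<in> S" "\<And>i. i \<in> W \<Longrightarrow> y \<in> (A \<circ> s) i ((\<sigma> \<circ> s) i)"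
    using shattersE[OF assms, of "\<sigma> \<circ> s"] by blast
  then show "\<exists>y\<in>S. \<forall>z\<in>s ` W. y \<in> A z (\<sigma> z)"
    by auto
qed

lemma shatters_comp_if_image:
  assumes "shatters A P S (s ` W)" "inj_on s W"
  shows "shatters (A \<circ> s) P S W"
  unfolding shatters_def
proof
  fix \<sigma> assume \<sigma>: "\<sigma> \<in> W \<rightarrow> P"
  define \<tau> where "\<tau> = \<sigma> \<circ> the_inv_into W s"
  have \<tau>: "\<tau> (s i) = \<sigma> i" if "i \<in> W" for i
    using assms(2) that by (simp add: \<tau>_def the_inv_into_f_f)
  then have "\<tau> z \<in> P" if "z \<in> s ` W" for z
    using \<sigma> that by auto
  then obtain y where "y \<in> S" "\<And>z. z \<in> s ` W \<Longrightarrow> y \<in> A z (\<tau> z)"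
    using shattersE[OF assms(1), of \<tau>] by blast
  then show "\<exists>y\<in>S. \<forall>z\<in>W. y \<in> (A \<circ> s) z (\<sigma> z)"
    using \<tau> by fastforce
qed

lemma shatters_comp_imp_inj_on:
  assumes "shatters (A \<circ> s) P S W" "p \<in> P" "q \<in> P" "\<And>z. A z p \<inter> A z q = {}"
  shows "inj_on s W"
proof (rule inj_onI, rule ccontr)
  fix i j assume ij: "i \<in> W" "j \<in> W" "s i = s j" "i \<noteq> j"
  have "(if z = i then p else q) \<in> P" for z
    using assms(2,3) by simp
  then obtain y where y: "\<And>z. z \<in> W \<Longrightarrow> y \<in> (A \<circ> s) z (if z = i then p else q)"
    using shattersE[OF assms(1), of "\<lambda>z. if z = i then p else q"] by blast
  then have "y \<in> A (s i) p \<inter> A (s i) q"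
    using y[of i] y[of j] ij by simp
  then show False
    using assms(4) by blast
qed

section \<open>Counting shattered sets\<close>

definition shattered_subsets ::
    "('i \<Rightarrow> 'p \<Rightarrow> 'a set) \<Rightarrow> 'p set \<Rightarrow> 'a set \<Rightarrow> 'i set \<Rightarrow> 'i set set" where
  "shattered_subsets A P S Z = {W. W \<subseteq> Z \<and> shatters A P S W}"

lemma finite_shattered_subsets: "finite Z \<Longrightarrow> finite (shattered_subsets A P S Z)"
  by (rule finite_subset[of _ "Pow Z"]) (auto simp: shattered_subsets_def)

lemma shattered_subsets_mono:
  "S \<subseteq> T \<Longrightarrow> Y \<subseteq> Z \<Longrightarrow> shattered_subsets A P S Y \<subseteq> shattered_subsets A P T Z"
  by (auto simp: shattered_subsets_def intro: shatters_mono)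

lemma card_shattered_subsets_insert_ge:
  assumes "finite Z" "z \<notin> Z" "P \<noteq> {}"
  shows "card (shattered_subsets A P S Z) + card (\<Inter>p\<in>P. shattered_subsets A P (S \<inter> A z p) Z)
           \<le> card (shattered_subsets A P S (insert z Z))"
proof -
  let ?I = "\<Inter>p\<in>P. shattered_subsets A P (S \<inter> A z p) Z"
  have subset: "W \<subseteq> Z" if "W \<in> ?I" for W
    using that assms(3) by (auto simp: shattered_subsets_def)
  have "finite ?I"
    by (rule finite_subset[of _ "Pow Z"]) (use subset assms(1) in auto)
  have "inj_on (insert z) ?I"
    using subset assms(2) by (intro inj_onI) (metis insert_ident subsetD)
  have "insert z W \<in> shattered_subsets A P S (insert z Z)" if "W \<in> ?I" for W
    using that subset[OF that] shatters_insert[of P A S z W] by (auto simp: shattered_subsets_def)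
  then have union:
      "shattered_subsets A P S Z \<union> insert z ` ?I \<subseteq> shattered_subsets A P S (insert z Z)"
    using shattered_subsets_mono[of S S Z "insert z Z"] by blast
  have "shattered_subsets A P S Z \<inter> insert z ` ?I = {}"
    using assms(2) by (auto simp: shattered_subsets_def)
  then have "card (shattered_subsets A P S Z) + card ?I
      = card (shattered_subsets A P S Z \<union> insert z ` ?I)"
    using \<open>finite ?I\<close> \<open>inj_on (insert z) ?I\<close> assms(1)
    by (simp add: card_Un_disjoint card_image finite_shattered_subsets)
  also have "\<dots> \<le> card (shattered_subsets A P S (insert z Z))"
    using union assms(1) by (intro card_mono finite_shattered_subsets) auto
  finally show ?thesis .
qed

lemma sum_card_le_card_plus_card_INTER:
  assumes "2 \<le> card P" "finite C" "\<And>p. p \<in> P \<Longrightarrow> D p \<subseteq> C"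
  shows "(\<Sum>p\<in>P. card (D p)) \<le> (card P - 1) * (card C + card (\<Inter>p\<in>P. D p))"
proof -
  let ?I = "\<Inter>p\<in>P. D p"
  have "finite P" "P \<noteq> {}"
    using assms(1) card_ge_0_finite[of P] by auto
  then have "?I \<subseteq> C"
    using assms(3) by blast
  have multiplicity: "card {p \<in> P. c \<in> D p} \<le> (card P - 1) * (1 + of_bool (c \<in> ?I))" for c
  proof (cases "c \<in> ?I")
    case True
    then have "{p \<in> P. c \<in> D p} = P" by blast
    then show ?thesis using True assms(1) by simp
  next
    case False
    then have "{p \<in> P. c \<in> D p} \<subset> P" by blast
    then have "card {p \<in> P. c \<in> D p} < card P"
      using \<open>finite P\<close> by (rule psubset_card_mono[rotated])
    then show ?thesis using False by simp
  qed
  have "(\<Sum>p\<in>P. card (D p)) = (\<Sum>p\<in>P. card {c \<in> C. c \<in> D p})"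
    using assms(3) by (intro sum.cong refl arg_cong[of _ _ card]) blast
  also have "\<dots> = (\<Sum>c\<in>C. card {p \<in> P. c \<in> D p})"
    using \<open>finite P\<close> assms(2) by (intro sum_multicount_gen) auto
  also have "\<dots> \<le> (\<Sum>c\<in>C. (card P - 1) * (1 + of_bool (c \<in> ?I)))"
    by (intro sum_mono multiplicity)
  also have "\<dots> = (card P - 1) * (card C + card (C \<inter> ?I))"
    unfolding sum_distrib_left[symmetric] sum.distrib
    using assms(2) by (simp add: sum.If_cases Int_def of_bool_def)
  also have "C \<inter> ?I = ?I"
    using \<open>?I \<subseteq> C\<close> by blast
  finally show ?thesis .
qed

lemma exists_label_with_few_shattered_subsets:
  assumes "finite Z" "z \<notin> Z" "2 \<le> card P"
  obtains p where "p \<in> P"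
    "card P * card (shattered_subsets A P (S \<inter> A z p) Z)
       \<le> (card P - 1) * card (shattered_subsets A P S (insert z Z))"
proof -
  let ?N = "\<lambda>p. card (shattered_subsets A P (S \<inter> A z p) Z)"
  have "finite P" "P \<noteq> {}"
    using assms(3) card_ge_0_finite[of P] by auto
  define p where "p = arg_min_on ?N P"
  have "p \<in> P"
    unfolding p_def using \<open>finite P\<close> \<open>P \<noteq> {}\<close> by (rule arg_min_if_finite)
  have min: "?N p \<le> ?N q" if "q \<in> P" for q
    unfolding p_def using \<open>finite P\<close> \<open>P \<noteq> {}\<close> that by (rule arg_min_least)
  have "card P * ?N p \<le> (\<Sum>q\<in>P. ?N q)"
    using sum_bounded_below[of P "?N p" ?N] min by simp
  also have "\<dots> \<le> (card P - 1) * (card (shattered_subsets A P S Z)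
      + card (\<Inter>q\<in>P. shattered_subsets A P (S \<inter> A z q) Z))"
    by (rule sum_card_le_card_plus_card_INTER)
      (use assms in \<open>simp_all add: finite_shattered_subsets shattered_subsets_mono\<close>)
  also have "\<dots> \<le> (card P - 1) * card (shattered_subsets A P S (insert z Z))"
    using assms \<open>P \<noteq> {}\<close> by (intro mult_left_mono card_shattered_subsets_insert_ge) auto
  finally show ?thesis
    using that \<open>p \<in> P\<close> by blast
qed

lemma exists_label_lowering_exponent:
  assumes "finite Z" "z \<notin> Z" "2 \<le> card P"
    and "card (shattered_subsets A P S (insert z Z)) * (card P - 1) ^ Suc d < card P ^ Suc d"
  obtains p where "p \<in> P"
    "card (shattered_subsets A P (S \<inter> A z p) Z) * (card P - 1) ^ d < card P ^ d"
proof -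
  let ?N = "card (shattered_subsets A P S (insert z Z))"
  obtain p where "p \<in> P"
    and p: "card P * card (shattered_subsets A P (S \<inter> A z p) Z) \<le> (card P - 1) * ?N"
    by (rule exists_label_with_few_shattered_subsets[OF assms(1-3)])
  have "card P * (card (shattered_subsets A P (S \<inter> A z p) Z) * (card P - 1) ^ d)
      \<le> (card P - 1) * ?N * (card P - 1) ^ d"
    using mult_le_mono1[OF p, of "(card P - 1) ^ d"] by (simp only: mult.assoc)
  also have "\<dots> < card P * card P ^ d"
    using assms(4) by (simp add: mult_ac)
  finally have "card (shattered_subsets A P (S \<inter> A z p) Z) * (card P - 1) ^ d < card P ^ d"
    by simp
  with \<open>p \<in> P\<close> show ?thesis
    by (rule that)
qed

lemma card_subsets_card_le:
  assumes "finite Z"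
  shows "card {W. W \<subseteq> Z \<and> card W \<le> m} \<le> (card Z + 1) ^ m"
proof (induction m)
  case 0
  have "{W. W \<subseteq> Z \<and> card W \<le> 0} = {{}}"
    using assms by (auto simp: card_eq_0_iff dest: finite_subset)
  then show ?case by simp
next
  case (Suc m)
  let ?\<W> = "\<lambda>m. {W. W \<subseteq> Z \<and> card W \<le> m}"
  let ?E = "insert {} ((\<lambda>z. {z}) ` Z)"
  have finite: "finite (?\<W> m)"
    using assms by simp
  have "?\<W> (Suc m) \<subseteq> (\<lambda>(E, W). E \<union> W) ` (?E \<times> ?\<W> m)"
  proof
    fix W assume W: "W \<in> ?\<W> (Suc m)"
    show "W \<in> (\<lambda>(E, W). E \<union> W) ` (?E \<times> ?\<W> m)"
    proof (cases "W = {}")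
      case False
      then obtain w where "w \<in> W" by blast
      then have "({w}, W - {w}) \<in> ?E \<times> ?\<W> m" "W = {w} \<union> (W - {w})"
        using W by auto
      then show ?thesis by blast
    qed auto
  qed
  then have "card (?\<W> (Suc m)) \<le> card (?E \<times> ?\<W> m)"
    using assms finite by (intro surj_card_le) auto
  also have "\<dots> = (card Z + 1) * card (?\<W> m)"
    using assms by (simp add: card_cartesian_product card_image image_iff)
  also have "\<dots> \<le> (card Z + 1) ^ Suc m"
    using mult_le_mono2[OF Suc.IH] by (simp only: power_Suc)
  finally show ?case .
qed

section \<open>Avoiding families\<close>

definition avoiding_family ::
    "('i \<Rightarrow> 'p \<Rightarrow> 'a set) \<Rightarrow> 'p set \<Rightarrow> 'a set \<Rightarrow> 'i set \<Rightarrow> ('i \<Rightarrow> 'p) set \<Rightarrow> bool" where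
  "avoiding_family A P S Z \<V> \<longleftrightarrow>
     finite \<V> \<and> \<V> \<subseteq> Z \<rightarrow> P \<and> S \<subseteq> (\<Union>V\<in>\<V>. \<Inter>z\<in>Z. - A z (V z))"

lemma other_element_if_card_ge_2:
  assumes "2 \<le> card P"
  obtains q where "q \<in> P" "q \<noteq> p"
proof -
  have "\<not> P \<subseteq> {p}"
    using assms card_mono[of "{p}" P] by auto
  then show ?thesis
    using that by blast
qed

lemma avoiding_family_PiE:
  assumes "finite Z" "2 \<le> card P" "\<And>z. z \<in> Z \<Longrightarrow> disjoint_family_on (A z) P"
  shows "avoiding_family A P S Z (Z \<rightarrow>\<^sub>E P)"
  unfolding avoiding_family_def
proof (intro conjI subsetI)
  have "finite P"
    using assms(2) card_ge_0_finite[of P] by simp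
  then show "finite (Z \<rightarrow>\<^sub>E P)"
    using assms(1) by (intro finite_PiE)
next
  fix y assume "y \<in> S"
  obtain p where "p \<in> P"
    using other_element_if_card_ge_2[OF assms(2)] .
  have "\<exists>p\<in>P. y \<notin> A z p" if "z \<in> Z" for z
  proof -
    obtain q where "q \<in> P" "q \<noteq> p"
      using other_element_if_card_ge_2[OF assms(2)] .
    then show ?thesis
      using disjoint_family_onD[OF assms(3)[OF that] \<open>p \<in> P\<close>] \<open>p \<in> P\<close> by blast
  qed
  then obtain V where "\<And>z. z \<in> Z \<Longrightarrow> V z \<in> P \<and> y \<notin> A z (V z)"
    by metis
  then have "restrict V Z \<in> Z \<rightarrow>\<^sub>E P" "y \<in> (\<Inter>z\<in>Z. - A z (restrict V Z z))"
    by auto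
  then show "y \<in> (\<Union>V\<in>Z \<rightarrow>\<^sub>E P. \<Inter>z\<in>Z. - A z (V z))"
    by blast
qed (simp add: assms PiE_iff Pi_iff subset_iff)

lemma power_card_le_card_avoiding_family:
  assumes "avoiding_family A P S Z \<V>" "shatters A P S W" "W \<subseteq> Z" "finite W" "finite P"
  shows "card P ^ card W \<le> card \<V> * (card P - 1) ^ card W"
proof -
  have \<V>: "finite \<V>" "\<V> \<subseteq> Z \<rightarrow> P" "S \<subseteq> (\<Union>V\<in>\<V>. \<Inter>z\<in>Z. - A z (V z))"
    using assms(1) by (auto simp: avoiding_family_def)
  have "W \<rightarrow>\<^sub>E P \<subseteq> (\<Union>V\<in>\<V>. \<Pi>\<^sub>E z\<in>W. P - {V z})"
  proof
    fix \<sigma> assume \<sigma>: "\<sigma> \<in> W \<rightarrow>\<^sub>E P"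
    then obtain y where y: "y \<in> S" "\<And>z. z \<in> W \<Longrightarrow> y \<in> A z (\<sigma> z)"
      using shattersE[OF assms(2), of \<sigma>] by blast
    then obtain V where "V \<in> \<V>" "y \<in> (\<Inter>z\<in>Z. - A z (V z))"
      using \<V>(3) by blast
    then have "\<sigma> z \<noteq> V z" if "z \<in> W" for z
      using y(2)[OF that] assms(3) that by auto
    then have "\<sigma> \<in> (\<Pi>\<^sub>E z\<in>W. P - {V z})"
      using \<sigma> by (simp add: PiE_iff)
    then show "\<sigma> \<in> (\<Union>V\<in>\<V>. \<Pi>\<^sub>E z\<in>W. P - {V z})"
      using \<open>V \<in> \<V>\<close> by blast
  qed
  then have "card (W \<rightarrow>\<^sub>E P) \<le> card (\<Union>V\<in>\<V>. \<Pi>\<^sub>E z\<in>W. P - {V z})"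
    using \<V>(1) assms(4,5) by (intro card_mono finite_UN_I finite_PiE) auto
  also have "\<dots> \<le> (\<Sum>V\<in>\<V>. card (\<Pi>\<^sub>E z\<in>W. P - {V z}))"
    using \<V>(1) by (rule card_UN_le)
  also have "\<dots> = (\<Sum>V\<in>\<V>. (card P - 1) ^ card W)"
  proof (intro sum.cong refl)
    fix V assume "V \<in> \<V>"
    then have "card (P - {V z}) = card P - 1" if "z \<in> W" for z
      using \<V>(2) assms(3) that by (intro card_Diff_singleton) blast
    then show "card (\<Pi>\<^sub>E z\<in>W. P - {V z}) = (card P - 1) ^ card W"
      using assms(4) by (simp add: card_PiE)
  qed
  finally show ?thesis
    using assms(4) by (simp add: card_PiE)
qed

lemma exists_avoiding_family_insert:
  assumes "avoiding_family A P (S \<inter> A z p) Z \<V>" "avoiding_family A P S Z \<V>'"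
    and "z \<notin> Z" "2 \<le> card P" "p \<in> P" "disjoint_family_on (A z) P"
  obtains \<U> where "avoiding_family A P S (insert z Z) \<U>" "card \<U> \<le> card \<V> + card \<V>'"
proof -
  have finite: "finite \<V>" "finite \<V>'" and words: "\<V> \<subseteq> Z \<rightarrow> P" "\<V>' \<subseteq> Z \<rightarrow> P"
    using assms(1,2) by (auto simp: avoiding_family_def)
  obtain q where q: "q \<in> P" "q \<noteq> p"
    using other_element_if_card_ge_2[OF assms(4)] .
  let ?\<U> = "(\<lambda>V. V(z := q)) ` \<V> \<union> (\<lambda>V. V(z := p)) ` \<V>'"
  have "\<exists>V\<in>?\<U>. \<forall>w\<in>insert z Z. y \<notin> A w (V w)" if y: "y \<in> S" for y
  proof (cases "y \<in> A z p")
    case True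
    then obtain V where V: "V \<in> \<V>" "\<forall>w\<in>Z. y \<notin> A w (V w)"
      using assms(1) y unfolding avoiding_family_def by blast
    have "y \<notin> A z q"
      using True disjoint_family_onD[OF assms(6,5) q(1)] q(2) by blast
    then have "\<forall>w\<in>insert z Z. y \<notin> A w ((V(z := q)) w)"
      using V(2) assms(3) by auto
    then show ?thesis
      using V(1) by blast
  next
    case False
    obtain V where V: "V \<in> \<V>'" "\<forall>w\<in>Z. y \<notin> A w (V w)"
      using assms(2) y unfolding avoiding_family_def by blast
    have "\<forall>w\<in>insert z Z. y \<notin> A w ((V(z := p)) w)"
      using V(2) False assms(3) by auto
    then show ?thesis
      using V(1) by blast
  qed
  then have "S \<subseteq> (\<Union>V\<in>?\<U>. \<Inter>w\<in>insert z Z. - A w (V w))"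
    unfolding subset_iff UN_iff INT_iff Compl_iff by blast
  moreover have "?\<U> \<subseteq> insert z Z \<rightarrow> P"
    using words assms(5) q(1) by (auto simp: Pi_iff subset_iff)
  ultimately have "avoiding_family A P S (insert z Z) ?\<U>"
    unfolding avoiding_family_def using finite by (intro conjI finite_UnI finite_imageI)
  moreover have "card ?\<U> \<le> card \<V> + card \<V>'"
    using finite by (meson add_mono card_Un_le card_image_le le_trans)
  ultimately show ?thesis
    by (rule that)
qed

lemma power_add_power_Suc_le: "n ^ e + n ^ Suc e \<le> (n + 1) ^ Suc e" for n :: nat
proof -
  have "n ^ e + n ^ Suc e = (n + 1) * n ^ e"
    by simp
  also have "\<dots> \<le> (n + 1) * (n + 1) ^ e"
    by (intro mult_left_mono power_mono) auto
  finally show ?thesis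
    by simp
qed

text \<open>At a new index z, let p be the label with few shattered subsets. The points outside of
  \<open>A z p\<close> may keep d, as they avoid p; those in \<open>A z p\<close> avoid any other label and lower d by one.\<close>

lemma exists_avoiding_family_if_few_shattered_subsets:
  assumes "finite Z" "2 \<le> card P" "\<And>z. z \<in> Z \<Longrightarrow> disjoint_family_on (A z) P"
    and "card (shattered_subsets A P S Z) * (card P - 1) ^ d < card P ^ d"
  obtains \<V> where "avoiding_family A P S Z \<V>" "card \<V> \<le> (card Z + 1) ^ d"
  using assms(1,3,4)
proof (induction Z arbitrary: S d thesis rule: finite_induct)
  case empty
  have "avoiding_family A P S {} {\<lambda>_. undefined}"
    by (simp add: avoiding_family_def)
  then show ?case
    using empty.prems(1) by simp
next
  case (insert z Z)
  show ?case
  proof (cases d)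
    case 0
    then have "shattered_subsets A P S (insert z Z) = {}"
      using insert.prems(3) insert.hyps(1) finite_shattered_subsets[of "insert z Z" A P S] by simp
    then have "S = {}"
      by (auto simp: shattered_subsets_def)
    then show ?thesis
      using insert.prems(1)[of "{}"] by (simp add: avoiding_family_def)
  next
    case (Suc e)
    obtain p where "p \<in> P"
      and "card (shattered_subsets A P (S \<inter> A z p) Z) * (card P - 1) ^ e < card P ^ e"
      using exists_label_lowering_exponent[OF insert.hyps assms(2)] insert.prems(3) Suc by blast
    then obtain \<V> where \<V>: "avoiding_family A P (S \<inter> A z p) Z \<V>" "card \<V> \<le> (card Z + 1) ^ e"
      using insert.IH insert.prems(2) by blast
    have "card (shattered_subsets A P S Z) \<le> card (shattered_subsets A P S (insert z Z))"
      using insert.hyps(1) by (intro card_mono finite_shattered_subsets shattered_subsets_mono) auto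
    then have "card (shattered_subsets A P S Z) * (card P - 1) ^ d < card P ^ d"
      using insert.prems(3) by (meson le_less_trans mult_le_mono1)
    then obtain \<V>' where \<V>': "avoiding_family A P S Z \<V>'" "card \<V>' \<le> (card Z + 1) ^ d"
      using insert.IH insert.prems(2) by blast
    obtain \<U> where \<U>: "avoiding_family A P S (insert z Z) \<U>" "card \<U> \<le> card \<V> + card \<V>'"
      by (rule exists_avoiding_family_insert[OF \<V>(1) \<V>'(1) insert.hyps(2) assms(2) \<open>p \<in> P\<close>])
        (use insert.prems(2) in auto)
    have "card \<U> \<le> (card Z + 1) ^ e + (card Z + 1) ^ Suc e"
      using \<V>(2) \<V>'(2) \<U>(2) Suc by simp
    also have "\<dots> \<le> (card (insert z Z) + 1) ^ d"
      using power_add_power_Suc_le[of "card Z + 1" e] insert.hyps Suc by simp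
    finally have "card \<U> \<le> (card (insert z Z) + 1) ^ d" .
    with \<U>(1) show ?thesis
      by (rule insert.prems(1))
  qed
qed

lemma exists_avoiding_family_if_card_shattered_le:
  assumes "finite Z" "2 \<le> card P" "\<And>z. z \<in> Z \<Longrightarrow> disjoint_family_on (A z) P"
    and "\<And>W. W \<subseteq> Z \<Longrightarrow> shatters A P S W \<Longrightarrow> card W \<le> M"
    and "(card Z + 1) ^ M * (card P - 1) ^ d < card P ^ d"
  obtains \<V> where "avoiding_family A P S Z \<V>" "card \<V> \<le> (card Z + 1) ^ d"
proof -
  have "card (shattered_subsets A P S Z) \<le> card {W. W \<subseteq> Z \<and> card W \<le> M}"
    using assms(1,4) by (intro card_mono) (auto simp: shattered_subsets_def)
  also have "\<dots> \<le> (card Z + 1) ^ M"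
    using assms(1) by (rule card_subsets_card_le)
  finally have "card (shattered_subsets A P S Z) * (card P - 1) ^ d < card P ^ d"
    using assms(5) by (meson le_less_trans mult_le_mono1)
  then show ?thesis
    using exists_avoiding_family_if_few_shattered_subsets[of Z P A S d] assms(1-3) that by blast
qed

section \<open>Sequence entropy and independence\<close>

definition translates :: "('g \<Rightarrow> 'x \<Rightarrow> 'x) \<Rightarrow> ('p \<Rightarrow> 'x set) \<Rightarrow> 'g \<Rightarrow> 'p \<Rightarrow> 'x set" where
  "translates act U g p = act g -` U p"

definition complement_cover :: "('p \<Rightarrow> 'x set) \<Rightarrow> 'p set \<Rightarrow> 'x set set" where
  "complement_cover U P = (\<lambda>p. - U p) ` P"

definition has_large_independence ::
    "('g \<Rightarrow> 'x \<Rightarrow> 'x) \<Rightarrow> ('p \<Rightarrow> 'x set) \<Rightarrow> 'p set \<Rightarrow> bool" where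
  "has_large_independence act U P \<longleftrightarrow>
     (\<forall>n. \<exists>J. finite J \<and> n \<le> card J \<and> shatters (translates act U) P UNIV J)"

lemma disjoint_family_on_translates:
  "disjoint_family_on U P \<Longrightarrow> disjoint_family_on (translates act U g) P"
  by (auto simp: disjoint_family_on_def translates_def)

lemma join_seq_complement_cover:
  "join_seq act s (complement_cover U P) n =
     (\<lambda>V. \<Inter>i\<in>{1..n}. - (translates act U \<circ> s) i (V i)) ` ({1..n} \<rightarrow> P)" (is "?J = ?B ` _")
proof (intro equalityI subsetI)
  fix B assume "B \<in> ?J"
  then obtain C where C: "B = (\<Inter>i\<in>{1..n}. act (s i) -` C i)"
    and "\<forall>i\<in>{1..n}. \<exists>p\<in>P. C i = - U p"
    unfolding join_seq_def complement_cover_def by blast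
  then obtain V where V: "\<And>i. i \<in> {1..n} \<Longrightarrow> V i \<in> P \<and> C i = - U (V i)"
    by metis
  then have "B = ?B V"
    unfolding C by (intro INF_cong) (auto simp: translates_def)
  then show "B \<in> ?B ` ({1..n} \<rightarrow> P)"
    using V by blast
next
  fix B assume "B \<in> ?B ` ({1..n} \<rightarrow> P)"
  then obtain V where "V \<in> {1..n} \<rightarrow> P" "B = (\<Inter>i\<in>{1..n}. act (s i) -` (- U (V i)))"
    by (auto simp: translates_def vimage_Compl)
  then show "B \<in> ?J"
    unfolding join_seq_def complement_cover_def by (auto intro!: exI[of _ "\<lambda>i. - U (V i)"])
qed

lemma N_cover_join_seq_le_card_avoiding_family:
  assumes "avoiding_family (translates act U \<circ> s) P UNIV {1..n} \<V>"
  shows "N_cover (join_seq act s (complement_cover U P) n) \<le> card \<V>"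
proof -
  let ?B = "\<lambda>V. \<Inter>i\<in>{1..n}. - (translates act U \<circ> s) i (V i)"
  have \<V>: "finite \<V>" "\<V> \<subseteq> {1..n} \<rightarrow> P" "\<Union>(?B ` \<V>) = UNIV"
    using assms unfolding avoiding_family_def by (simp_all only: top.extremum_unique)
  have "N_cover (join_seq act s (complement_cover U P) n) \<le> card (?B ` \<V>)"
    unfolding N_cover_def join_seq_complement_cover
    using \<V> by (intro Least_le exI[of _ "?B ` \<V>"] conjI image_mono finite_imageI refl)
  also have "\<dots> \<le> card \<V>"
    using \<V>(1) by (rule card_image_le)
  finally show ?thesis .
qed

lemma exists_avoiding_family_card_N_cover:
  assumes "2 \<le> card P" "disjoint_family_on U P"
  obtains \<V> where "avoiding_family (translates act U \<circ> s) P UNIV {1..n} \<V>"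
    "card \<V> = N_cover (join_seq act s (complement_cover U P) n)"
proof -
  let ?B = "\<lambda>V. \<Inter>i\<in>{1..n}. - (translates act U \<circ> s) i (V i)"
  let ?C = "join_seq act s (complement_cover U P) n"
  let ?Q = "\<lambda>m. \<exists>F. F \<subseteq> ?C \<and> finite F \<and> card F = m \<and> \<Union>F = UNIV"
  have "avoiding_family (translates act U \<circ> s) P UNIV {1..n} ({1..n} \<rightarrow>\<^sub>E P)"
    using assms by (intro avoiding_family_PiE) (auto intro: disjoint_family_on_translates)
  then have words: "finite ({1..n} \<rightarrow>\<^sub>E P)" "({1..n} \<rightarrow>\<^sub>E P) \<subseteq> {1..n} \<rightarrow> P"
    "\<Union>(?B ` ({1..n} \<rightarrow>\<^sub>E P)) = UNIV"
    unfolding avoiding_family_def by (simp_all only: top.extremum_unique)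
  have "?Q (card (?B ` ({1..n} \<rightarrow>\<^sub>E P)))"
    unfolding join_seq_complement_cover
    using words by (intro exI[of _ "?B ` ({1..n} \<rightarrow>\<^sub>E P)"] conjI image_mono finite_imageI refl)
  then have "?Q (N_cover ?C)"
    unfolding N_cover_def by (rule LeastI)
  then obtain F where F: "F \<subseteq> ?C" "finite F" "card F = N_cover ?C" "\<Union>F = UNIV"
    by blast
  then obtain \<V> where \<V>: "\<V> \<subseteq> {1..n} \<rightarrow> P" "inj_on ?B \<V>" "F = ?B ` \<V>"
    unfolding join_seq_complement_cover subset_image_inj by blast
  have "avoiding_family (translates act U \<circ> s) P UNIV {1..n} \<V>"
    unfolding avoiding_family_def
    using F(2,4) \<V>(1) finite_image_iff[OF \<V>(2)] unfolding \<V>(3)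
    by (simp only: subset_refl simp_thms)
  then show ?thesis
    using that F(3) \<V> card_image[OF \<V>(2)] by metis
qed

lemma ln_N_cover_join_seq_ge:
  assumes "2 \<le> card P" "disjoint_family_on U P"
    and "shatters (translates act U \<circ> s) P UNIV W" "W \<subseteq> {1..n}"
  shows "real (card W) * ln (real (card P) / (real (card P) - 1))
           \<le> ln (real (N_cover (join_seq act s (complement_cover U P) n)))"
proof -
  let ?N = "N_cover (join_seq act s (complement_cover U P) n)"
  let ?l = "real (card P)"
  have "finite W" "finite P"
    using assms(1,4) finite_subset card_ge_0_finite[of P] by auto
  obtain \<V> where \<V>: "avoiding_family (translates act U \<circ> s) P UNIV {1..n} \<V>" "card \<V> = ?N"
    using exists_avoiding_family_card_N_cover[OF assms(1,2)] .
  have "card P ^ card W \<le> ?N * (card P - 1) ^ card W"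
    using power_card_le_card_avoiding_family[OF \<V>(1) assms(3,4) \<open>finite W\<close> \<open>finite P\<close>]
    unfolding \<V>(2) .
  then have "real (card P ^ card W) \<le> real (?N * (card P - 1) ^ card W)"
    by (simp only: of_nat_le_iff)
  then have "(?l / (?l - 1)) ^ card W \<le> real ?N"
    using assms(1) by (simp add: of_nat_diff power_divide divide_le_eq)
  moreover have "0 < ?l / (?l - 1)"
    using assms(1) by simp
  ultimately have "ln ((?l / (?l - 1)) ^ card W) \<le> ln (real ?N)"
    by (intro ln_mono zero_less_power)
  then show ?thesis
    using \<open>0 < ?l / (?l - 1)\<close> by (simp only: ln_realpow)
qed

lemma le_Limsup_if_frequently_le:
  fixes X :: "'a \<Rightarrow> 'b::complete_linorder"
  assumes "\<exists>\<^sub>F n in F. c \<le> X n"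
  shows "c \<le> Limsup F X"
proof (rule ccontr)
  assume "\<not> c \<le> Limsup F X"
  then have "\<forall>\<^sub>F n in F. X n < c"
    by (intro Limsup_lessD) simp
  then show False
    using assms by (simp add: frequently_def not_le)
qed

lemma htop_seq_ge_if_frequently_shatters:
  assumes "2 \<le> card P" "disjoint_family_on U P" "0 \<le> \<delta>"
    and "\<exists>\<^sub>F n in sequentially. \<exists>W\<subseteq>{1..n}.
           \<delta> * real n \<le> real (card W) \<and> shatters (translates act U \<circ> s) P UNIV W"
  shows "ereal (\<delta> * ln (real (card P) / (real (card P) - 1)))
           \<le> htop_seq act (complement_cover U P) s"
proof -
  let ?c = "ln (real (card P) / (real (card P) - 1))"
  let ?h = "\<lambda>n. ln (real (N_cover (join_seq act s (complement_cover U P) n))) / real n"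
  have "0 \<le> ?c"
    using assms(1) by simp
  have bound: "\<delta> * ?c \<le> ?h n"
    if "0 < n" and W: "W \<subseteq> {1..n}" "\<delta> * real n \<le> real (card W)"
      "shatters (translates act U \<circ> s) P UNIV W" for n W
  proof -
    have "\<delta> * real n * ?c \<le> real (card W) * ?c"
      using W(2) \<open>0 \<le> ?c\<close> by (rule mult_right_mono)
    also have "\<dots> \<le> ln (real (N_cover (join_seq act s (complement_cover U P) n)))"
      using assms(1,2) W(3,1) by (rule ln_N_cover_join_seq_ge)
    finally show ?thesis
      using \<open>0 < n\<close> by (simp add: le_divide_eq mult_ac)
  qed
  have "\<exists>\<^sub>F n in sequentially. ereal (\<delta> * ?c) \<le> ereal (?h n)"
    using frequently_eventually_frequently[OF assms(4) eventually_gt_at_top[of 0]]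
    by (rule frequently_elim1) (use bound in auto)
  then show ?thesis
    unfolding htop_seq_def by (rule le_Limsup_if_frequently_le)
qed

lemma exists_map_shattering_if_has_large_independence:
  assumes "has_large_independence act U P" "P \<noteq> {}" "finite B"
  obtains e where "shatters (translates act U \<circ> e) P UNIV B"
proof -
  obtain J where J: "finite J" "card B \<le> card J" "shatters (translates act U) P UNIV J"
    using assms(1) unfolding has_large_independence_def by blast
  then obtain e where "e ` B \<subseteq> J" "inj_on e B"
    using card_le_inj[OF assms(3)] by blast
  then have "shatters (translates act U \<circ> e) P UNIV B"
    using shatters_subset[OF J(3) _ assms(2)] by (intro shatters_comp_if_image)
  then show ?thesis
    by (rule that)
qed

lemma exists_seq_shattering_dyadic_blocks:
  assumes "has_large_independence act U P" "P \<noteq> {}"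
  obtains s :: "nat \<Rightarrow> 'g"
    where "\<forall>m. shatters (translates act U \<circ> s) P UNIV {2 ^ m..<2 ^ Suc m}"
proof -
  let ?block = "\<lambda>m. {2 ^ m..<2 ^ Suc m} :: nat set"
  have "\<exists>e. shatters (translates act U \<circ> e) P UNIV (?block m)" for m
    using exists_map_shattering_if_has_large_independence[OF assms finite_atLeastLessThan] by metis
  then obtain e where e: "\<And>m. shatters (translates act U \<circ> e m) P UNIV (?block m)"
    by metis
  define s where "s i = e (floor_log i) i" for i
  have s: "s i = e m i" if "i \<in> ?block m" for i m
  proof -
    have "0 < i"
      using that by (cases i) auto
    then have "floor_log i = m"
      using that by (intro floor_log_eqI) auto
    then show ?thesis
      by (simp add: s_def)
  qed
  have "shatters (translates act U \<circ> s) P UNIV (?block m)" for m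
    using e[of m] subset_refl by (rule shatters_mono) (simp add: s)
  then show ?thesis
    using that by blast
qed

lemma ln_N_cover_join_seq_le:
  assumes "2 \<le> card P" "disjoint_family_on U P"
    and "\<And>W. W \<subseteq> {1..n} \<Longrightarrow> shatters (translates act U \<circ> s) P UNIV W \<Longrightarrow> card W \<le> M"
  shows "ln (real (N_cover (join_seq act s (complement_cover U P) n)))
           \<le> (real M * ln (real n + 1) / ln (real (card P) / (real (card P) - 1)) + 1)
             * ln (real n + 1)"
proof -
  let ?N = "N_cover (join_seq act s (complement_cover U P) n)"
  let ?l = "real (card P)"
  let ?c = "ln (?l / (?l - 1))"
  let ?t = "real M * ln (real n + 1) / ?c"
  define d where "d = nat \<lfloor>?t\<rfloor> + 1"
  have l: "2 \<le> ?l"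
    using assms(1) by simp
  then have "0 < ?c" by simp
  then have d: "?t < real d" "real d \<le> ?t + 1"
    unfolding d_def by (linarith, simp)
  have "ln ((real n + 1) ^ M * (?l - 1) ^ d) < ln (?l ^ d)"
    using d(1) \<open>0 < ?c\<close> l by (simp add: ln_mult ln_realpow ln_div field_simps)
  then have "(real n + 1) ^ M * (?l - 1) ^ d < ?l ^ d"
    using l by (subst (asm) ln_less_cancel_iff) auto
  then have "real ((card {1..n} + 1) ^ M * (card P - 1) ^ d) < real (card P ^ d)"
    using assms(1) by (simp add: of_nat_diff add.commute)
  then have few: "(card {1..n} + 1) ^ M * (card P - 1) ^ d < card P ^ d"
    by (simp only: of_nat_less_iff)
  have disjoint: "disjoint_family_on ((translates act U \<circ> s) i) P" for i
    using assms(2) by (simp add: disjoint_family_on_translates)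
  obtain \<V> where "avoiding_family (translates act U \<circ> s) P UNIV {1..n} \<V>"
    "card \<V> \<le> (card {1..n} + 1) ^ d"
    by (rule exists_avoiding_family_if_card_shattered_le
        [OF finite_atLeastAtMost assms(1) disjoint assms(3) few])
  then have "?N \<le> (n + 1) ^ d"
    using N_cover_join_seq_le_card_avoiding_family[of act U s P n \<V>] by simp
  then have "real ?N \<le> (real n + 1) ^ d"
    by (metis of_nat_1 of_nat_add of_nat_le_iff of_nat_power)
  then have "ln (real ?N) \<le> real d * ln (real n + 1)"
    by (cases "?N = 0") (simp_all flip: ln_realpow)
  also have "\<dots> \<le> (?t + 1) * ln (real n + 1)"
    using d(2) by (rule mult_right_mono) simp
  finally show ?thesis .
qed

lemma htop_seq_le_0_if_card_shattered_le:
  assumes "2 \<le> card P" "disjoint_family_on U P"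
    and "\<And>W. finite W \<Longrightarrow> shatters (translates act U \<circ> s) P UNIV W \<Longrightarrow> card W \<le> M"
  shows "htop_seq act (complement_cover U P) s \<le> 0"
proof -
  define m where "m = real M"
  define c where "c = ln (real (card P) / (real (card P) - 1))"
  let ?g = "\<lambda>n. (m * ln (real n + 1) / c + 1) * ln (real n + 1) / real n"
  have "0 < c"
    using assms(1) by (simp add: c_def)
  have "ln (real (N_cover (join_seq act s (complement_cover U P) n))) / real n \<le> ?g n" for n
    unfolding m_def c_def using assms
    by (intro divide_right_mono ln_N_cover_join_seq_le) (auto intro: finite_subset)
  then have "htop_seq act (complement_cover U P) s \<le> limsup (\<lambda>n. ereal (?g n))"
    unfolding htop_seq_def by (intro Limsup_mono always_eventually allI) simp
  also have "?g \<longlonglongrightarrow> 0"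
    using \<open>0 < c\<close> by real_asymp
  then have "limsup (\<lambda>n. ereal (?g n)) = 0"
    by (simp add: lim_imp_Limsup zero_ereal_def)
  finally show ?thesis .
qed

lemma has_large_independence_if_htop_seq_pos:
  assumes "2 \<le> card P" "disjoint_family_on U P" "0 < htop_seq act (complement_cover U P) s"
  shows "has_large_independence act U P"
  unfolding has_large_independence_def
proof
  fix n
  obtain q where "q \<in> P"
    using other_element_if_card_ge_2[OF assms(1)] .
  obtain p where "p \<in> P" "p \<noteq> q"
    using other_element_if_card_ge_2[OF assms(1)] .
  have disjoint: "translates act U g p \<inter> translates act U g q = {}" for g
    using disjoint_family_on_translates[OF assms(2)] \<open>p \<in> P\<close> \<open>q \<in> P\<close> \<open>p \<noteq> q\<close>
    by (rule disjoint_family_onD)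
  obtain W where W: "finite W" "shatters (translates act U \<circ> s) P UNIV W" "n < card W"
    using htop_seq_le_0_if_card_shattered_le[OF assms(1,2), of act s n] assms(3) by (meson not_le)
  have "inj_on s W"
    using W(2) \<open>p \<in> P\<close> \<open>q \<in> P\<close> disjoint by (rule shatters_comp_imp_inj_on)
  then have "n \<le> card (s ` W)"
    using W(3) by (simp add: card_image)
  then show "\<exists>J. finite J \<and> n \<le> card J \<and> shatters (translates act U) P UNIV J"
    using W(1) shatters_image_if_comp[OF W(2)] by blast
qed

lemma exists_htop_seq_pos_if_has_large_independence:
  fixes act :: "'g \<Rightarrow> 'x \<Rightarrow> 'x"
  assumes "2 \<le> card P" "disjoint_family_on U P" "has_large_independence act U P"
  obtains s where "0 < htop_seq act (complement_cover U P) s"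
proof -
  let ?\<delta> = "1 / 2 :: real"
  let ?c = "ln (real (card P) / (real (card P) - 1))"
  have "P \<noteq> {}"
    using assms(1) by auto
  obtain s :: "nat \<Rightarrow> 'g"
    where s: "\<forall>m. shatters (translates act U \<circ> s) P UNIV {2 ^ m..<2 ^ Suc m}"
    using exists_seq_shattering_dyadic_blocks[OF assms(3) \<open>P \<noteq> {}\<close>] .
  have "\<exists>n\<ge>m. \<exists>W\<subseteq>{1..n}. ?\<delta> * real n \<le> real (card W) \<and>
      shatters (translates act U \<circ> s) P UNIV W" for m
  proof (intro exI conjI)
    show "m \<le> 2 ^ Suc m"
      using less_exp[of "Suc m"] by linarith
    show "{2 ^ m..<2 ^ Suc m} \<subseteq> {1..2 ^ Suc m :: nat}"
      by (auto intro: order_trans[of _ "2 ^ m"])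
    show "?\<delta> * real (2 ^ Suc m) \<le> real (card {2 ^ m..<2 ^ Suc m :: nat})"
      by simp
  qed (use s in blast)
  then have "ereal (?\<delta> * ?c) \<le> htop_seq act (complement_cover U P) s"
    using assms(1,2)
    by (intro htop_seq_ge_if_frequently_shatters) (simp_all only: frequently_sequentially, simp)
  moreover have "0 < ereal (?\<delta> * ?c)"
    using assms(1) by simp
  ultimately show ?thesis
    using that less_le_trans by blast
qed

theorem htop_seq_pos_iff_has_large_independence:
  assumes "2 \<le> card P" "disjoint_family_on U P"
  shows "(\<exists>s. 0 < htop_seq act (complement_cover U P) s) \<longleftrightarrow> has_large_independence act U P"
  using has_large_independence_if_htop_seq_pos exists_htop_seq_pos_if_has_large_independence assms
  by metis

section \<open>Separating neighbourhoods\<close>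

lemma disjoint_open_neighbourhoods:
  fixes P :: "'x::t2_space set"
  assumes "finite P"
  obtains B where "\<And>p. p \<in> P \<Longrightarrow> open (B p) \<and> p \<in> B p" "disjoint_family_on B P"
proof -
  have "\<forall>p q :: 'x. \<exists>C D. p \<noteq> q \<longrightarrow> open C \<and> open D \<and> p \<in> C \<and> q \<in> D \<and> C \<inter> D = {}"
    by (meson hausdorff)
  then obtain C D where CD: "\<And>p q :: 'x. p \<noteq> q \<Longrightarrow>
      open (C p q) \<and> open (D p q) \<and> p \<in> C p q \<and> q \<in> D p q \<and> C p q \<inter> D p q = {}"
    by metis
  define B where "B p = (\<Inter>q\<in>P - {p}. C p q \<inter> D q p)" for p
  have "open (C p q \<inter> D q p) \<and> p \<in> C p q \<inter> D q p" if "q \<noteq> p" for p q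
    using CD[of p q] CD[of q p] that by auto
  then have "open (B p) \<and> p \<in> B p" for p
    unfolding B_def using assms by (intro conjI open_INT) auto
  moreover have "disjoint_family_on B P"
    unfolding disjoint_family_on_def
  proof (intro ballI impI)
    fix p q assume "p \<in> P" "q \<in> P" "p \<noteq> q"
    then have "B p \<subseteq> C p q" "B q \<subseteq> D p q"
      by (auto simp: B_def)
    then show "B p \<inter> B q = {}"
      using CD[OF \<open>p \<noteq> q\<close>] by blast
  qed
  ultimately show ?thesis
    using that by blast
qed

lemma closed_neighbourhood_within_open:
  fixes p :: "'x::t2_space"
  assumes "compact (UNIV :: 'x set)" "open B" "p \<in> B"
  obtains V where "closed V" "p \<in> interior V" "V \<subseteq> B"
proof -
  have "compact_space (euclidean :: 'x topology)"
    using assms(1) by (simp add: compact_space_def)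
  moreover have "Hausdorff_space (euclidean :: 'x topology)"
    using hausdorff by (simp add: Hausdorff_space_def disjnt_def) blast
  ultimately have "regular_space (euclidean :: 'x topology)"
    by (rule compact_Hausdorff_imp_regular_space)
  then have "neighbourhood_base_of (closedin euclidean) (euclidean :: 'x topology)"
    by (simp only: neighbourhood_base_of_closedin)
  then obtain T V where "open T" "closed V" "p \<in> T" "T \<subseteq> V" "V \<subseteq> B"
    using assms(2,3) unfolding neighbourhood_base_of by (metis open_openin closed_closedin)
  then show ?thesis
    using that interiorI by blast
qed

lemma disjoint_closed_neighbourhoods_within_open:
  fixes P :: "'x::t2_space set"
  assumes "compact (UNIV :: 'x set)" "finite P" "\<And>p. p \<in> P \<Longrightarrow> open (B p) \<and> p \<in> B p"
  obtains V where "\<And>p. p \<in> P \<Longrightarrow> closed (V p) \<and> p \<in> interior (V p) \<and> V p \<subseteq> B p"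
    "disjoint_family_on V P"
proof -
  obtain C where C: "\<And>p. p \<in> P \<Longrightarrow> open (C p) \<and> p \<in> C p" "disjoint_family_on C P"
    using disjoint_open_neighbourhoods[OF assms(2)] by blast
  have "\<exists>V. closed V \<and> p \<in> interior V \<and> V \<subseteq> B p \<inter> C p" if "p \<in> P" for p
    using closed_neighbourhood_within_open[OF assms(1), of "B p \<inter> C p" p] assms(3) C(1) that
    by (metis IntI open_Int)
  then obtain V where V: "\<And>p. p \<in> P \<Longrightarrow> closed (V p) \<and> p \<in> interior (V p) \<and> V p \<subseteq> B p \<inter> C p"
    by metis
  moreover have "disjoint_family_on V P"
    using C(2) V unfolding disjoint_family_on_def by (meson disjoint_iff le_inf_iff subsetD)
  ultimately show ?thesis
    using that by blast
qed

section \<open>Entropy tuples and independence tuples\<close>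

lemma independence_set_iff_shatters:
  assumes "finite J" "0 < k"
  shows "independence_set act k A J \<longleftrightarrow> shatters (translates act A) {..<k} UNIV J"
proof
  assume independent: "independence_set act k A J"
  show "shatters (translates act A) {..<k} UNIV J"
  proof (cases "J = {}")
    case False
    then have "(\<Inter>s\<in>J. act s -` A (\<sigma> s)) \<noteq> {}" if "\<sigma> \<in> J \<rightarrow> {..<k}" for \<sigma>
      using independent that assms(1) unfolding independence_set_def by (simp add: Pi_iff)
    then show ?thesis
      unfolding shatters_def translates_def by (simp add: ex_in_conv[symmetric])
  qed simp
next
  assume shatters: "shatters (translates act A) {..<k} UNIV J"
  show "independence_set act k A J"
    unfolding independence_set_def
  proof (intro allI impI, elim conjE)
    fix I \<sigma> assume "I \<subseteq> J" and \<sigma>: "\<forall>s\<in>I. \<sigma> s < k"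
    have "shatters (translates act A) {..<k} UNIV I"
      using shatters \<open>I \<subseteq> J\<close> by (rule shatters_subset) (use assms(2) in auto)
    then obtain y where "\<And>s. s \<in> I \<Longrightarrow> y \<in> translates act A s (\<sigma> s)"
      using \<sigma> by (elim shattersE[where \<sigma> = \<sigma>]) auto
    then show "(\<Inter>s\<in>I. act s -` A (\<sigma> s)) \<noteq> {}"
      unfolding translates_def by blast
  qed
qed

lemma has_large_independence_image_labels:
  "has_large_independence act U (x ` K) \<longleftrightarrow> has_large_independence act (U \<circ> x) K"
  by (simp add: has_large_independence_def shatters_image_labels translates_def[abs_def])

lemma has_large_independence_mono:
  assumes "has_large_independence act U P" "\<And>p. p \<in> P \<Longrightarrow> U p \<subseteq> V p"
  shows "has_large_independence act V P"
proof -
  have "translates act U g p \<subseteq> translates act V g p" if "p \<in> P" for g p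
    using assms(2)[OF that] by (auto simp: translates_def)
  then have "shatters (translates act V) P UNIV J" if "shatters (translates act U) P UNIV J" for J
    using shatters_mono[OF that subset_refl] by blast
  then show ?thesis
    using assms(1) unfolding has_large_independence_def by blast
qed

lemma card_image_ge_2_if_not_in_diagonal:
  assumes "\<not> in_diagonal k x"
  shows "2 \<le> card (x ` {..<k})"
proof -
  obtain i j where ij: "i < k" "j < k" "x i \<noteq> x j"
    using assms by (auto simp: in_diagonal_def)
  then have "card {x i, x j} \<le> card (x ` {..<k})"
    by (intro card_mono) auto
  then show ?thesis
    using ij(3) by simp
qed

lemma seq_entropy_tuple_iff_has_large_independence:
  assumes "\<not> in_diagonal k x"
  shows "seq_entropy_tuple act k x \<longleftrightarrow>
    (\<forall>U. (\<forall>p\<in>x ` {..<k}. closed (U p) \<and> p \<in> interior (U p)) \<and> disjoint_family_on U (x ` {..<k})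
      \<longrightarrow> has_large_independence act (U \<circ> x) {..<k})"
proof -
  have "(\<exists>s. 0 < htop_seq act (complement_cover U (x ` {..<k})) s)
      \<longleftrightarrow> has_large_independence act (U \<circ> x) {..<k}" if "disjoint_family_on U (x ` {..<k})" for U
    using htop_seq_pos_iff_has_large_independence
        [OF card_image_ge_2_if_not_in_diagonal[OF assms] that]
    by (simp only: has_large_independence_image_labels)
  then show ?thesis
    using assms
    unfolding seq_entropy_tuple_def complement_cover_def[symmetric]
      disjoint_family_on_def[symmetric]
    by blast
qed

lemma IN_tuple_iff_has_large_independence:
  assumes "0 < k"
  shows "IN_tuple act k x \<longleftrightarrow>
    (\<forall>U. (\<forall>i<k. x i \<in> interior (U i)) \<longrightarrow> has_large_independence act U {..<k})"
  unfolding IN_tuple_def has_large_independence_def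
  using independence_set_iff_shatters[OF _ assms] by metis

lemma seq_entropy_tuple_imp_IN_tuple:
  fixes x :: "nat \<Rightarrow> 'x::t2_space"
  assumes "compact (UNIV :: 'x set)" "seq_entropy_tuple act k x"
  shows "IN_tuple act k x"
proof -
  have off_diagonal: "\<not> in_diagonal k x"
    using assms(2) by (simp add: seq_entropy_tuple_def)
  then have "0 < k"
    by (auto simp: in_diagonal_def)
  have "has_large_independence act U {..<k}" if U: "\<forall>i<k. x i \<in> interior (U i)" for U
  proof -
    define N where "N p = (\<Inter>i\<in>{i. i < k \<and> x i = p}. interior (U i))" for p
    have N: "open (N p) \<and> p \<in> N p" for p
      using U by (auto simp: N_def intro!: open_INT)
    obtain V where V: "\<And>p. p \<in> x ` {..<k} \<Longrightarrow> closed (V p) \<and> p \<in> interior (V p) \<and> V p \<subseteq> N p"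
      "disjoint_family_on V (x ` {..<k})"
      using disjoint_closed_neighbourhoods_within_open
        [OF assms(1) finite_imageI[OF finite_lessThan] N, of x k]
      by blast
    then have "has_large_independence act (V \<circ> x) {..<k}"
      using assms(2) seq_entropy_tuple_iff_has_large_independence[OF off_diagonal] by blast
    moreover have "(V \<circ> x) i \<subseteq> U i" if "i \<in> {..<k}" for i
      using V(1)[of "x i"] that interior_subset[of "U i"] by (auto simp: N_def)
    ultimately show ?thesis
      by (rule has_large_independence_mono)
  qed
  then show ?thesis
    using IN_tuple_iff_has_large_independence[OF \<open>0 < k\<close>] by blast
qed

lemma IN_tuple_imp_seq_entropy_tuple:
  assumes "\<not> in_diagonal k x" "IN_tuple act k x"
  shows "seq_entropy_tuple act k x"
proof -
  have "0 < k"
    using assms(1) by (auto simp: in_diagonal_def)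
  show ?thesis
    unfolding seq_entropy_tuple_iff_has_large_independence[OF assms(1)]
  proof (intro allI impI, elim conjE)
    fix U assume "\<forall>p\<in>x ` {..<k}. closed (U p) \<and> p \<in> interior (U p)"
    then have "\<forall>i<k. x i \<in> interior ((U \<circ> x) i)"
      by simp
    then show "has_large_independence act (U \<circ> x) {..<k}"
      using assms(2) unfolding IN_tuple_iff_has_large_independence[OF \<open>0 < k\<close>] by blast
  qed
qed

theorem theorem5p9:
  fixes act :: "'g::{topological_space,monoid_mult} \<Rightarrow> 'x::t2_space \<Rightarrow> 'x"
    and k :: nat and x :: "nat \<Rightarrow> 'x"
  assumes "top_monoid_action act"
    and "k \<ge> 2"
    and "\<not> in_diagonal k x"
  shows "seq_entropy_tuple act k x \<longleftrightarrow> IN_tuple act k x"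
proof
  have "compact (UNIV :: 'x set)"
    using assms(1) by (simp add: top_monoid_action_def)
  then show "IN_tuple act k x" if "seq_entropy_tuple act k x"
    using that by (rule seq_entropy_tuple_imp_IN_tuple)
  show "seq_entropy_tuple act k x" if "IN_tuple act k x"
    using assms(3) that by (rule IN_tuple_imp_seq_entropy_tuple)
qed

end
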